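(* Let $m\ge 2$ be a positive integer. Then \[ BR_m(K_{2,2},K_{3,3})=\begin{cases} \text{does not exist}, & \text{if } m=2,3,\\ 15, & \text{if } m=4,\\ 12, & \text{if } m=5,6,\\ 9, & \text{if } m=7,8. \end{cases} \]
   Context: All graphs are finite, simple and undirected. $K_{m,n}$ denotes the complete bipartite graph with partite sets of sizes $m$ and $n$. For bipartite graphs $G$ and $H$ and a positive integer $m$, the $m$-bipartite Ramsey number $BR_m(G,H)$ is the smallest positive integer $n$ such that every red-blue coloring of the edges of $K_{m,n}$ results in a red $G$ or a blue $H$, i.e. a (not necessarily induced) subgraph isomorphic to $G$ all of whose edges are red, or a subgraph isomorphic to $H$ all of whose edges are blue. "Does not exist" means that there is no positive integer $n$ with this property. *)

theory Defs
  imports Main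
begin

record 'a graph =
  verts :: "'a set"
  edges :: "'a set set"

definition simple_graph :: "'a graph \<Rightarrow> bool" where
  "simple_graph G \<longleftrightarrow>
     finite (verts G) \<and> (\<forall>e\<in>edges G. e \<subseteq> verts G \<and> card e = 2)"

definition subgraph :: "'a graph \<Rightarrow> 'a graph \<Rightarrow> bool" where
  "subgraph S G \<longleftrightarrow>
     simple_graph S \<and> verts S \<subseteq> verts G \<and> edges S \<subseteq> edges G"

definition isomorphic :: "'a graph \<Rightarrow> 'b graph \<Rightarrow> bool" where
  "isomorphic G H \<longleftrightarrow>
     (\<exists>f. bij_betw f (verts G) (verts H) \<and> edges H = image f ` edges G)"

definition complete_bipartite :: "nat \<Rightarrow> nat \<Rightarrow> (nat + nat) graph" where
  "complete_bipartite m n =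
     \<lparr>verts = Inl ` {..<m} \<union> Inr ` {..<n},
      edges = {{Inl i, Inr j} | i j. i < m \<and> j < n}\<rparr>"

lemma simple_graph_complete_bipartite: "simple_graph (complete_bipartite m n)"
  by (auto simp: simple_graph_def complete_bipartite_def)

datatype colour = Red | Blue

definition has_mono_copy ::
    "colour \<Rightarrow> ('a set \<Rightarrow> colour) \<Rightarrow> 'a graph \<Rightarrow> 'b graph \<Rightarrow> bool" where
  "has_mono_copy k c F G \<longleftrightarrow>
     (\<exists>S. subgraph S F \<and> isomorphic S G \<and> (\<forall>e\<in>edges S. c e = k))"

(* Colourings are total functions; their values off the edges of K_{m,n} are irrelevant. *)
definition bipartite_arrows :: "nat \<Rightarrow> nat \<Rightarrow> 'a graph \<Rightarrow> 'b graph \<Rightarrow> bool" where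
  "bipartite_arrows m n G H \<longleftrightarrow>
     (\<forall>c. has_mono_copy Red c (complete_bipartite m n) G \<or>
          has_mono_copy Blue c (complete_bipartite m n) H)"

(* None means that the m-bipartite Ramsey number does not exist. *)
definition BR :: "nat \<Rightarrow> 'a graph \<Rightarrow> 'b graph \<Rightarrow> nat option" where
  "BR m G H =
     (if \<exists>n>0. bipartite_arrows m n G H
      then Some (LEAST n. n > 0 \<and> bipartite_arrows m n G H)
      else None)"

end

theory Submission
  imports Defs "HOL.Binomial"
begin

text \<open>A colouring of \<open>K\<^sub>m\<^sub>,\<^sub>n\<close> is the same as a family of \<open>n\<close> blocks in an \<open>m\<close>-set of points: the
  block of a column is the set of rows joined to it in red. There is no red \<open>K\<^sub>2\<^sub>,\<^sub>2\<close> iff any two blocks share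
  at most one point, and no blue \<open>K\<^sub>3\<^sub>,\<^sub>3\<close> iff any three together miss at most two points
  (\<open>arrows_iff_no_avoiding\<close>). The theorem thus asks for the largest such families.

  The upper bounds start from two counts: each pair of points lies in at most one block, and each triple
  is missed by at most two (\<open>sum_pairs_le\<close>, \<open>sum_missed_triples_le\<close>). A suitable combination
  of the two settles four points, where at most 14 blocks are possible. On five points it leaves a single
  way to have 12 blocks, namely all pairs and two singletons, and that one fails. On seven points
  counting is too weak by itself; it only yields a point on four of the nine blocks, and the blocks around
  this point leave room for too few others (\<open>seven_points_card_neq_9\<close>). Deleting rows carries the bounds
  for five and seven points over to six and eight.

  The lower bounds come from highly symmetric families: all singletons twice and all pairs on four points;
  the edges and the two sides of a \<open>K\<^sub>3\<^sub>,\<^sub>3\<close> on six points; the Moebius--Kantor configuration on eight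
  points. Deleting rows carries them over to five and seven points. On at most three points, one red row
  gives a good colouring for every number of columns.\<close>

section \<open>Colourings as set families\<close>

text \<open>A biclique with nonempty sides is connected, so an embedding into a bipartite graph respects the
  two sides up to swapping them; the image of a single vertex decides which of the two happens. Since
  both sides have the same size, a swapped copy is a copy as well.\<close>

lemma has_mono_copy_biclique_iff:
  assumes "a > 0"
  shows "has_mono_copy k c (complete_bipartite m n) (complete_bipartite a a) \<longleftrightarrow>
    (\<exists>S T. S \<subseteq> {..<m} \<and> T \<subseteq> {..<n} \<and> card S = a \<and> card T = a \<and>
       (\<forall>i\<in>S. \<forall>j\<in>T. c {Inl i, Inr j} = k))"
    (is "?copy \<longleftrightarrow> ?biclique")
proof
  assume ?copy
  then obtain H f where sub: "subgraph H (complete_bipartite m n)"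
    and f: "bij_betw f (verts H) (verts (complete_bipartite a a))"
    and edges_f: "edges (complete_bipartite a a) = image f ` edges H"
    and mono: "\<forall>e\<in>edges H. c e = k"
    unfolding has_mono_copy_def isomorphic_def by blast
  define g where "g = inv_into (verts H) f"
  have g: "bij_betw g (verts (complete_bipartite a a)) (verts H)"
    unfolding g_def using f by (rule bij_betw_inv_into)
  have inj_g: "inj_on g (Inl ` {..<a} \<union> Inr ` {..<a})"
    using bij_betw_imp_inj_on[OF g] by (simp add: complete_bipartite_def)
  have g_edge: "{g (Inl i), g (Inr j)} \<in> edges H" if "i < a" "j < a" for i j
  proof -
    have "{Inl i, Inr j} \<in> edges (complete_bipartite a a)"
      using that by (auto simp: complete_bipartite_def)
    then obtain e where e: "e \<in> edges H" "{Inl i, Inr j} = f ` e"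
      using edges_f by blast
    have "e \<subseteq> verts H"
      using e(1) sub by (auto simp: subgraph_def simple_graph_def)
    then have "g ` f ` e = e"
      unfolding g_def using bij_betw_imp_inj_on[OF f] by (rule inv_into_image_cancel[rotated])
    then show ?thesis
      using e by (metis image_empty image_insert)
  qed
  have host: "\<exists>p q. {g (Inl i), g (Inr j)} = {Inl p, Inr q} \<and> p < m \<and> q < n"
    if "i < a" "j < a" for i j
    using g_edge[OF that] sub by (auto simp: subgraph_def complete_bipartite_def)
  have c_edge: "c {g (Inl i), g (Inr j)} = k" if "i < a" "j < a" for i j
    using g_edge[OF that] mono by blast
  have sides: ?biclique
    if u: "\<And>i. i < a \<Longrightarrow> u i < m" "inj_on u {..<a}"
      and v: "\<And>i. i < a \<Longrightarrow> v i < n" "inj_on v {..<a}"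
      and uv: "\<And>i j. i < a \<Longrightarrow> j < a \<Longrightarrow> c {Inl (u i), Inr (v j)} = k"
    for u v :: "nat \<Rightarrow> nat"
    using u v uv by (intro exI[of _ "u ` {..<a}"] exI[of _ "v ` {..<a}"]) (auto simp: card_image)
  show ?biclique
  proof (cases "g (Inl 0)")
    case (Inl p0)
    have "\<exists>q. g (Inr j) = Inr q \<and> q < n" if "j < a" for j
      using host[OF assms that] Inl by (auto simp: doubleton_eq_iff)
    then obtain v where v: "\<And>j. j < a \<Longrightarrow> g (Inr j) = Inr (v j) \<and> v j < n"
      by metis
    have "\<exists>p. g (Inl i) = Inl p \<and> p < m" if "i < a" for i
      using host[OF that assms] v[OF assms] by (auto simp: doubleton_eq_iff)
    then obtain u where u: "\<And>i. i < a \<Longrightarrow> g (Inl i) = Inl (u i) \<and> u i < m"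
      by metis
    have "inj_on u {..<a}"
    proof (rule inj_onI)
      fix x y assume "x \<in> {..<a}" "y \<in> {..<a}" "u x = u y"
      then show "x = y" using u inj_onD[OF inj_g, of "Inl x" "Inl y"] by auto
    qed
    moreover have "inj_on v {..<a}"
    proof (rule inj_onI)
      fix x y assume "x \<in> {..<a}" "y \<in> {..<a}" "v x = v y"
      then show "x = y" using v inj_onD[OF inj_g, of "Inr x" "Inr y"] by auto
    qed
    ultimately show ?thesis
      using sides[of u v] u v c_edge by metis
  next
    case (Inr q0)
    have "\<exists>p. g (Inr j) = Inl p \<and> p < m" if "j < a" for j
      using host[OF assms that] Inr by (auto simp: doubleton_eq_iff)
    then obtain u where u: "\<And>j. j < a \<Longrightarrow> g (Inr j) = Inl (u j) \<and> u j < m"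
      by metis
    have "\<exists>q. g (Inl i) = Inr q \<and> q < n" if "i < a" for i
      using host[OF that assms] u[OF assms] by (auto simp: doubleton_eq_iff)
    then obtain v where v: "\<And>i. i < a \<Longrightarrow> g (Inl i) = Inr (v i) \<and> v i < n"
      by metis
    have c_uv: "c {Inl (u j), Inr (v i)} = k" if "j < a" "i < a" for i j
      using c_edge[OF that(2,1)] u[OF that(1)] v[OF that(2)] by (simp add: insert_commute)
    have "inj_on u {..<a}"
    proof (rule inj_onI)
      fix x y assume "x \<in> {..<a}" "y \<in> {..<a}" "u x = u y"
      then show "x = y" using u inj_onD[OF inj_g, of "Inr x" "Inr y"] by auto
    qed
    moreover have "inj_on v {..<a}"
    proof (rule inj_onI)
      fix x y assume "x \<in> {..<a}" "y \<in> {..<a}" "v x = v y"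
      then show "x = y" using v inj_onD[OF inj_g, of "Inl x" "Inl y"] by auto
    qed
    ultimately show ?thesis
      using sides[of u v] u v c_uv by blast
  qed
next
  assume ?biclique
  then obtain S T where S: "S \<subseteq> {..<m}" "card S = a" and T: "T \<subseteq> {..<n}" "card T = a"
    and mono: "\<And>i j. i \<in> S \<Longrightarrow> j \<in> T \<Longrightarrow> c {Inl i, Inr j} = k"
    by blast
  have fin: "finite S" "finite T"
    using S T finite_subset by blast+
  obtain s where s: "bij_betw s S {..<a}"
    using fin(1) S(2) ex_bij_betw_finite_nat[of S] by (auto simp: atLeast0LessThan)
  obtain t where t: "bij_betw t T {..<a}"
    using fin(2) T(2) ex_bij_betw_finite_nat[of T] by (auto simp: atLeast0LessThan)
  define H :: "(nat + nat) graph" where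
    "H = \<lparr>verts = Inl ` S \<union> Inr ` T, edges = {{Inl i, Inr j} | i j. i \<in> S \<and> j \<in> T}\<rparr>"
  have "subgraph H (complete_bipartite m n)"
    using S(1) T(1) fin
    by (auto simp: H_def subgraph_def simple_graph_def complete_bipartite_def)
  moreover have "isomorphic H (complete_bipartite a a)"
    unfolding isomorphic_def
  proof (rule exI[of _ "map_sum s t"], rule conjI)
    let ?f = "map_sum s t"
    have st: "inj_on s S" "inj_on t T" "s ` S = {..<a}" "t ` T = {..<a}"
      using s t by (auto simp: bij_betw_def)
    show "bij_betw ?f (verts H) (verts (complete_bipartite a a))"
      unfolding bij_betw_def
    proof
      show "inj_on ?f (verts H)"
      proof (rule inj_onI)
        fix x y assume "x \<in> verts H" "y \<in> verts H" "?f x = ?f y"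
        then show "x = y"
          by (cases x; cases y) (auto simp: H_def inj_on_eq_iff[OF st(1)] inj_on_eq_iff[OF st(2)])
      qed
      have "?f ` verts H = Inl ` s ` S \<union> Inr ` t ` T"
        by (simp add: H_def image_Un image_image)
      then show "?f ` verts H = verts (complete_bipartite a a)"
        by (simp only: st(3,4)) (simp add: complete_bipartite_def)
    qed
    have "image ?f ` edges H = (\<lambda>(i, j). {Inl (s i), Inr (t j)}) ` (S \<times> T)"
    proof -
      have "edges H = (\<lambda>(i, j). {Inl i, Inr j}) ` (S \<times> T)"
        by (auto simp: H_def)
      then show ?thesis
        by (simp add: image_image case_prod_unfold)
    qed
    also have "\<dots> = {{Inl i, Inr j} | i j. i \<in> s ` S \<and> j \<in> t ` T}"
      by auto
    finally show "edges (complete_bipartite a a) = image ?f ` edges H"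
      using st(3,4) by (simp add: complete_bipartite_def)
  qed
  moreover have "\<forall>e\<in>edges H. c e = k"
    using mono by (auto simp: H_def)
  ultimately show ?copy
    unfolding has_mono_copy_def by blast
qed

text \<open>Here \<open>P\<close> is the set of rows and \<open>B j\<close> the set of rows joined in red to column \<open>j\<close>. Two columns
  with two common red rows form a red \<open>K\<^sub>2\<^sub>,\<^sub>2\<close>, and three columns with three common non-red
  rows form a blue \<open>K\<^sub>3\<^sub>,\<^sub>3\<close>. Only the traces of the blocks on \<open>P\<close> matter, which lets rows be deleted
  without changing the blocks.\<close>

definition avoiding :: "'a set \<Rightarrow> 'j set \<Rightarrow> ('j \<Rightarrow> 'a set) \<Rightarrow> bool" where
  "avoiding P J B \<longleftrightarrow>
     (\<forall>i\<in>J. \<forall>j\<in>J. i \<noteq> j \<longrightarrow> card (P \<inter> B i \<inter> B j) \<le> 1) \<and>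
     (\<forall>i\<in>J. \<forall>j\<in>J. \<forall>k\<in>J. i \<noteq> j \<and> i \<noteq> k \<and> j \<noteq> k \<longrightarrow>
        card (P - (B i \<union> B j \<union> B k)) \<le> 2)"

lemma avoiding_meet:
  "avoiding P J B \<Longrightarrow> i \<in> J \<Longrightarrow> j \<in> J \<Longrightarrow> i \<noteq> j \<Longrightarrow> card (P \<inter> B i \<inter> B j) \<le> 1"
  unfolding avoiding_def by blast

lemma avoiding_miss:
  "avoiding P J B \<Longrightarrow> i \<in> J \<Longrightarrow> j \<in> J \<Longrightarrow> k \<in> J \<Longrightarrow> i \<noteq> j \<Longrightarrow> i \<noteq> k \<Longrightarrow> j \<noteq> k \<Longrightarrow>
    card (P - (B i \<union> B j \<union> B k)) \<le> 2"
  unfolding avoiding_def by blast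

lemma avoiding_mono:
  assumes "avoiding P J B" "finite P" "P' \<subseteq> P" "J' \<subseteq> J"
  shows "avoiding P' J' B"
  unfolding avoiding_def
proof (intro conjI ballI impI)
  fix i j assume "i \<in> J'" "j \<in> J'" "i \<noteq> j"
  then have "card (P \<inter> B i \<inter> B j) \<le> 1"
    using assms(1,4) by (blast intro: avoiding_meet)
  moreover have "card (P' \<inter> B i \<inter> B j) \<le> card (P \<inter> B i \<inter> B j)"
    using assms(2,3) by (auto intro: card_mono)
  ultimately show "card (P' \<inter> B i \<inter> B j) \<le> 1" by simp
next
  fix i j k assume "i \<in> J'" "j \<in> J'" "k \<in> J'" "i \<noteq> j \<and> i \<noteq> k \<and> j \<noteq> k"
  then have "card (P - (B i \<union> B j \<union> B k)) \<le> 2"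
    using assms(1,4) by (blast intro: avoiding_miss)
  moreover have "card (P' - (B i \<union> B j \<union> B k)) \<le> card (P - (B i \<union> B j \<union> B k))"
    using assms(2,3) by (auto intro: card_mono)
  ultimately show "card (P' - (B i \<union> B j \<union> B k)) \<le> 2" by simp
qed

lemma avoiding_ordered:
  fixes J :: "'j :: linorder set"
  assumes "\<And>i j. i \<in> J \<Longrightarrow> j \<in> J \<Longrightarrow> i < j \<Longrightarrow> card (P \<inter> B i \<inter> B j) \<le> 1"
    and "\<And>i j k. i \<in> J \<Longrightarrow> j \<in> J \<Longrightarrow> k \<in> J \<Longrightarrow> i < j \<Longrightarrow> j < k \<Longrightarrow>
           card (P - (B i \<union> B j \<union> B k)) \<le> 2"
  shows "avoiding P J B"
  unfolding avoiding_def
proof (intro conjI ballI impI)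
  fix i j assume "i \<in> J" "j \<in> J" "i \<noteq> j"
  then show "card (P \<inter> B i \<inter> B j) \<le> 1"
    using assms(1)[of i j] assms(1)[of j i] by (metis Int_assoc Int_commute linorder_neqE)
next
  fix i j k assume "i \<in> J" "j \<in> J" "k \<in> J" "i \<noteq> j \<and> i \<noteq> k \<and> j \<noteq> k"
  then show "card (P - (B i \<union> B j \<union> B k)) \<le> 2"
    using assms(2)[of i j k] assms(2)[of i k j] assms(2)[of j i k]
      assms(2)[of j k i] assms(2)[of k i j] assms(2)[of k j i]
    by (cases i j rule: linorder_cases; cases i k rule: linorder_cases;
        cases j k rule: linorder_cases) (simp_all add: Un_ac)
qed

lemma arrows_iff_no_avoiding:
  "bipartite_arrows m n (complete_bipartite 2 2) (complete_bipartite 3 3) \<longleftrightarrow>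
     (\<nexists>B. avoiding {..<m} {..<n} B)"
proof -
  have red: "(\<exists>S T. S \<subseteq> {..<m} \<and> T \<subseteq> {..<n} \<and> card S = 2 \<and> card T = 2 \<and>
       (\<forall>i\<in>S. \<forall>j\<in>T. i \<in> B j)) \<longleftrightarrow>
     \<not> (\<forall>i<n. \<forall>j<n. i \<noteq> j \<longrightarrow> card ({..<m} \<inter> B i \<inter> B j) \<le> 1)" for B :: "nat \<Rightarrow> nat set"
  proof
    assume "\<exists>S T. S \<subseteq> {..<m} \<and> T \<subseteq> {..<n} \<and> card S = 2 \<and> card T = 2 \<and>
       (\<forall>i\<in>S. \<forall>j\<in>T. i \<in> B j)"
    then obtain S T where S: "S \<subseteq> {..<m}" "card S = 2"
      and T: "T \<subseteq> {..<n}" "card T = 2" and ST: "\<forall>i\<in>S. \<forall>j\<in>T. i \<in> B j"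
      by blast
    obtain j j' where "T = {j, j'}" "j \<noteq> j'"
      using T(2) unfolding card_2_iff by blast
    then have j: "j < n" "j' < n" "j \<noteq> j'" and B: "\<forall>i\<in>S. i \<in> B j \<and> i \<in> B j'"
      using T(1) ST by auto
    have "card S \<le> card ({..<m} \<inter> B j \<inter> B j')"
      using S B by (intro card_mono) auto
    then show "\<not> (\<forall>i<n. \<forall>j<n. i \<noteq> j \<longrightarrow> card ({..<m} \<inter> B i \<inter> B j) \<le> 1)"
      using S(2) j by force
  next
    assume "\<not> (\<forall>i<n. \<forall>j<n. i \<noteq> j \<longrightarrow> card ({..<m} \<inter> B i \<inter> B j) \<le> 1)"
    then obtain j j' where j: "j < n" "j' < n" "j \<noteq> j'" "2 \<le> card ({..<m} \<inter> B j \<inter> B j')"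
      by (auto simp: not_le)
    obtain S where "S \<subseteq> {..<m} \<inter> B j \<inter> B j'" "card S = 2"
      using obtain_subset_with_card_n[OF j(4)] by blast
    then show "\<exists>S T. S \<subseteq> {..<m} \<and> T \<subseteq> {..<n} \<and> card S = 2 \<and> card T = 2 \<and>
       (\<forall>i\<in>S. \<forall>j\<in>T. i \<in> B j)"
      using j by (intro exI[of _ S] exI[of _ "{j, j'}"]) auto
  qed
  have blue: "(\<exists>S T. S \<subseteq> {..<m} \<and> T \<subseteq> {..<n} \<and> card S = 3 \<and> card T = 3 \<and>
       (\<forall>i\<in>S. \<forall>j\<in>T. i \<notin> B j)) \<longleftrightarrow>
     \<not> (\<forall>i<n. \<forall>j<n. \<forall>k<n. i \<noteq> j \<and> i \<noteq> k \<and> j \<noteq> k \<longrightarrow>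
          card ({..<m} - (B i \<union> B j \<union> B k)) \<le> 2)" for B :: "nat \<Rightarrow> nat set"
  proof
    assume "\<exists>S T. S \<subseteq> {..<m} \<and> T \<subseteq> {..<n} \<and> card S = 3 \<and> card T = 3 \<and>
       (\<forall>i\<in>S. \<forall>j\<in>T. i \<notin> B j)"
    then obtain S T where S: "S \<subseteq> {..<m}" "card S = 3"
      and T: "T \<subseteq> {..<n}" "card T = 3" and B: "\<And>i j. i \<in> S \<Longrightarrow> j \<in> T \<Longrightarrow> i \<notin> B j"
      by blast
    obtain j k l where jkl: "T = {j, k, l}" "j \<noteq> k" "k \<noteq> l" "j \<noteq> l"
      using T(2) unfolding card_3_iff by blast
    have "card S \<le> card ({..<m} - (B j \<union> B k \<union> B l))"
      using S(1) B jkl(1) by (intro card_mono) auto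
    then show "\<not> (\<forall>i<n. \<forall>j<n. \<forall>k<n. i \<noteq> j \<and> i \<noteq> k \<and> j \<noteq> k \<longrightarrow>
          card ({..<m} - (B i \<union> B j \<union> B k)) \<le> 2)"
      using S(2) T(1) jkl by force
  next
    assume "\<not> (\<forall>i<n. \<forall>j<n. \<forall>k<n. i \<noteq> j \<and> i \<noteq> k \<and> j \<noteq> k \<longrightarrow>
          card ({..<m} - (B i \<union> B j \<union> B k)) \<le> 2)"
    then obtain j k l where jkl: "j < n" "k < n" "l < n" "j \<noteq> k" "j \<noteq> l" "k \<noteq> l"
      "3 \<le> card ({..<m} - (B j \<union> B k \<union> B l))"
      by (auto simp: not_le)
    obtain S where "S \<subseteq> {..<m} - (B j \<union> B k \<union> B l)" "card S = 3"
      using obtain_subset_with_card_n[OF jkl(7)] by blast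
    then show "\<exists>S T. S \<subseteq> {..<m} \<and> T \<subseteq> {..<n} \<and> card S = 3 \<and> card T = 3 \<and>
       (\<forall>i\<in>S. \<forall>j\<in>T. i \<notin> B j)"
      using jkl by (intro exI[of _ S] exI[of _ "{j, k, l}"]) auto
  qed
  have colouring: "has_mono_copy Red c (complete_bipartite m n) (complete_bipartite 2 2) \<or>
      has_mono_copy Blue c (complete_bipartite m n) (complete_bipartite 3 3) \<longleftrightarrow>
      \<not> avoiding {..<m} {..<n} B"
    if B: "\<And>i j. i \<in> B j \<longleftrightarrow> c {Inl i, Inr j} = Red" for c B
  proof -
    have Blue: "c e = Blue \<longleftrightarrow> c e \<noteq> Red" for e
      by (cases "c e") auto
    show ?thesis
      using red[of B] blue[of B]
      by (simp add: has_mono_copy_biclique_iff Blue avoiding_def B Ball_def)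
  qed
  show ?thesis
  proof
    assume arrows: "bipartite_arrows m n (complete_bipartite 2 2) (complete_bipartite 3 3)"
    show "\<nexists>B. avoiding {..<m} {..<n} B"
    proof
      assume "\<exists>B. avoiding {..<m} {..<n} B"
      then obtain B where B: "avoiding {..<m} {..<n} B" ..
      define c :: "(nat + nat) set \<Rightarrow> colour" where
        "c e = (if \<exists>i j. e = {Inl i, Inr j} \<and> i \<in> B j then Red else Blue)" for e
      have "i \<in> B j \<longleftrightarrow> c {Inl i, Inr j} = Red" for i j
        by (auto simp: c_def doubleton_eq_iff)
      then show False
        using arrows colouring[of B c] B unfolding bipartite_arrows_def by blast
    qed
  next
    assume none: "\<nexists>B. avoiding {..<m} {..<n} B"
    show "bipartite_arrows m n (complete_bipartite 2 2) (complete_bipartite 3 3)"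
      unfolding bipartite_arrows_def
    proof
      fix c :: "(nat + nat) set \<Rightarrow> colour"
      show "has_mono_copy Red c (complete_bipartite m n) (complete_bipartite 2 2) \<or>
          has_mono_copy Blue c (complete_bipartite m n) (complete_bipartite 3 3)"
        using colouring[of "\<lambda>j. {i. c {Inl i, Inr j} = Red}" c] none by blast
    qed
  qed
qed

text \<open>One avoiding family with \<open>n\<close> columns rules out every smaller number of columns too, because
  columns can be deleted.\<close>

lemma BR_eq_SomeI:
  assumes "\<And>B. \<not> avoiding {..<m} {..<N} B" and "avoiding {..<m} {..<n} C" and N: "N = Suc n"
  shows "BR m (complete_bipartite 2 2) (complete_bipartite 3 3) = Some N"
proof -
  let ?arrows = "\<lambda>n. bipartite_arrows m n (complete_bipartite 2 2) (complete_bipartite 3 3)"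
  have "?arrows (Suc n)"
    using assms(1) unfolding arrows_iff_no_avoiding N by blast
  moreover have "Suc n \<le> k" if "?arrows k" for k
  proof (rule ccontr)
    assume "\<not> Suc n \<le> k"
    then have "avoiding {..<m} {..<k} C"
      by (intro avoiding_mono[OF assms(2)]) auto
    then show False
      using that unfolding arrows_iff_no_avoiding by blast
  qed
  ultimately have "(LEAST n. n > 0 \<and> ?arrows n) = Suc n"
    by (intro Least_equality) auto
  moreover have "\<exists>n>0. ?arrows n"
    using \<open>?arrows (Suc n)\<close> by blast
  ultimately show ?thesis
    by (simp add: BR_def N)
qed

lemma BR_eq_NoneI:
  fixes C :: "nat \<Rightarrow> nat \<Rightarrow> nat set"
  assumes "\<And>n. avoiding {..<m} {..<n} (C n)"
  shows "BR m (complete_bipartite 2 2) (complete_bipartite 3 3) = None"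
proof -
  have "\<not> bipartite_arrows m n (complete_bipartite 2 2) (complete_bipartite 3 3)" for n
    unfolding arrows_iff_no_avoiding using assms[of n] by blast
  then show ?thesis
    by (simp add: BR_def)
qed

section \<open>Counting pairs and missed triples\<close>

text \<open>Double counting of the pairs \<open>(j, T)\<close> where \<open>T\<close> is a \<open>k\<close>-subset of \<open>X j\<close>.\<close>

lemma sum_binomial_le:
  assumes P: "finite P" and J: "finite J" and X: "\<And>j. j \<in> J \<Longrightarrow> X j \<subseteq> P"
    and t: "\<And>T. T \<subseteq> P \<Longrightarrow> card T = k \<Longrightarrow> card {j \<in> J. T \<subseteq> X j} \<le> t"
  shows "(\<Sum>j\<in>J. card (X j) choose k) \<le> t * (card P choose k)"
proof -
  let ?K = "{T. T \<subseteq> P \<and> card T = k}"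
  have finK: "finite ?K"
    using P by (auto intro: finite_subset[of _ "Pow P"])
  have "(\<Sum>j\<in>J. card (X j) choose k) = (\<Sum>j\<in>J. card {T \<in> ?K. T \<subseteq> X j})"
  proof (rule sum.cong[OF refl])
    fix j assume j: "j \<in> J"
    have "{T \<in> ?K. T \<subseteq> X j} = {T. T \<subseteq> X j \<and> card T = k}"
      using X[OF j] by auto
    then show "card (X j) choose k = card {T \<in> ?K. T \<subseteq> X j}"
      using n_subsets[of "X j" k] finite_subset[OF X[OF j] P] by simp
  qed
  also have "\<dots> = (\<Sum>T\<in>?K. card {j \<in> J. T \<subseteq> X j})"
    using J finK by (intro sum_multicount_gen) auto
  also have "\<dots> \<le> (\<Sum>T\<in>?K. t)"
    using t by (intro sum_mono) auto
  also have "\<dots> = t * (card P choose k)"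
    using n_subsets[OF P, of k] by simp
  finally show ?thesis .
qed

locale avoiding_family =
  fixes P :: "'a set" and J :: "'j set" and B :: "'j \<Rightarrow> 'a set"
  assumes finP: "finite P" and finJ: "finite J"
    and block_subset: "j \<in> J \<Longrightarrow> B j \<subseteq> P"
    and av: "avoiding P J B"
begin

lemma finite_block: "j \<in> J \<Longrightarrow> finite (B j)"
  using block_subset finP finite_subset by blast

lemma card_inter_le: "i \<in> J \<Longrightarrow> j \<in> J \<Longrightarrow> i \<noteq> j \<Longrightarrow> card (B i \<inter> B j) \<le> 1"
  using avoiding_meet[OF av, of i j] block_subset[of i] by (simp add: Int_absorb1)

lemma common_point_unique:
  "i \<in> J \<Longrightarrow> j \<in> J \<Longrightarrow> i \<noteq> j \<Longrightarrow> x \<in> B i \<Longrightarrow> x \<in> B j \<Longrightarrow> y \<in> B i \<Longrightarrow> y \<in> B j \<Longrightarrow> x = y"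
  using card_inter_le[of i j] finite_block[of i] by (auto simp: card_le_Suc0_iff_eq)

lemma card_union_ge:
  assumes "i \<in> J" "j \<in> J" "k \<in> J" "i \<noteq> j" "i \<noteq> k" "j \<noteq> k"
  shows "card P \<le> card (B i \<union> B j \<union> B k) + 2"
proof -
  have "card (P - (B i \<union> B j \<union> B k)) = card P - card (B i \<union> B j \<union> B k)"
    using assms finite_block block_subset by (intro card_Diff_subset) auto
  then show ?thesis
    using avoiding_miss[OF av assms] by simp
qed

text \<open>Every pair of points lies in at most one block, and every triple of points is missed by at most
  two blocks. Summed over all pairs and all triples, this bounds the block sizes.\<close>

lemma sum_pairs_le: "(\<Sum>j\<in>J. card (B j) choose 2) \<le> card P choose 2"
proof -
  have "card {j \<in> J. T \<subseteq> B j} \<le> 1" if T: "card T = 2" for T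
  proof -
    obtain x y where "x \<noteq> y" "T = {x, y}"
      using T by (auto simp: card_2_iff)
    then show ?thesis
      using finJ common_point_unique[of _ _ x y] by (auto simp: card_le_Suc0_iff_eq)
  qed
  then show ?thesis
    using sum_binomial_le[of P J B 2 1] finP finJ block_subset by simp
qed

lemma sum_missed_triples_le:
  "(\<Sum>j\<in>J. (card P - card (B j)) choose 3) \<le> 2 * (card P choose 3)"
proof -
  have "card {j \<in> J. T \<subseteq> P - B j} \<le> 2" if T: "T \<subseteq> P" "card T = 3" for T
  proof (rule ccontr)
    assume "\<not> ?thesis"
    then obtain D where D: "D \<subseteq> {j \<in> J. T \<subseteq> P - B j}" "card D = 3"
      using obtain_subset_with_card_n[of 3] by (metis Suc_leI not_le numeral_3_eq_3 numeral_2_eq_2)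
    obtain i j k where ijk: "D = {i, j, k}" "i \<noteq> j" "j \<noteq> k" "i \<noteq> k"
      using D(2) unfolding card_3_iff by blast
    have "card T \<le> card (P - (B i \<union> B j \<union> B k))"
      using D(1) ijk(1) finP by (intro card_mono) auto
    then show False
      using avoiding_miss[OF av, of i j k] D(1) ijk T(2) by auto
  qed
  moreover have "card (P - B j) = card P - card (B j)" if "j \<in> J" for j
    using that block_subset finite_block by (simp add: card_Diff_subset)
  ultimately show ?thesis
    using sum_binomial_le[of P J "\<lambda>j. P - B j" 3 2] finP finJ by simp
qed

end

section \<open>Upper bounds for four, five and seven points\<close>

lemma choose_small:
  "(0::nat) choose 2 = 0" "(1::nat) choose 2 = 0" "(2::nat) choose 2 = 1" "(3::nat) choose 2 = 3"
  "(4::nat) choose 2 = 6" "(5::nat) choose 2 = 10"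
  "(0::nat) choose 3 = 0" "(1::nat) choose 3 = 0" "(2::nat) choose 3 = 0" "(3::nat) choose 3 = 1"
  "(4::nat) choose 3 = 4" "(5::nat) choose 3 = 10" "(6::nat) choose 3 = 20" "(7::nat) choose 3 = 35"
  by (simp_all add: numeral_eq_Suc)

context avoiding_family
begin

lemma card_block_le: "j \<in> J \<Longrightarrow> card (B j) \<le> card P"
  using block_subset finP by (intro card_mono) auto

text \<open>Weigh a block of size \<open>r\<close> by the \<open>r choose 2\<close> pairs in it plus the \<open>(4 - r) choose 3\<close> triples
  it misses. The total weight is at most \<open>6 + 2 * 4 = 14\<close>, and every block has positive weight.\<close>

lemma four_points_card_le_14:
  assumes P: "card P = 4"
  shows "card J \<le> 14"
proof -
  have "1 \<le> (card (B j) choose 2) + ((4 - card (B j)) choose 3)" if j: "j \<in> J" for j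
  proof -
    have "card (B j) \<in> {0, 1, 2, 3, 4}"
      using card_block_le[OF j] P by auto
    then show ?thesis
      by (auto simp: choose_small)
  qed
  from sum_bounded_below[OF this]
  have "card J \<le> (\<Sum>j\<in>J. (card (B j) choose 2) + ((4 - card (B j)) choose 3))"
    by simp
  also have "\<dots> \<le> 6 + 2 * 4"
    using sum_pairs_le sum_missed_triples_le unfolding P sum.distrib choose_small by simp
  finally show ?thesis by simp
qed

text \<open>Counting alone leaves one case open. Pairs get weight 3 and missed triples weight 1, the ratio
  for which sizes 1 and 2 both cost 4 and every other size costs at least 9, out of a total of
  \<open>3 * 10 + 2 * 10 = 50\<close>. Twelve blocks therefore all have size 1 or 2, and the separate bounds on
  pairs and triples force exactly two singletons and ten 2-sets. The latter are all the pairs of points,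
  so one of them contains both singletons, and these three blocks miss a triple.\<close>

lemma five_points_card_neq_12:
  assumes P: "card P = 5"
  shows "card J \<noteq> 12"
proof
  assume J: "card J = 12"
  let ?w = "\<lambda>j. 3 * (card (B j) choose 2) + ((5 - card (B j)) choose 3)"
  have pairs: "(\<Sum>j\<in>J. card (B j) choose 2) \<le> 10"
    and triples: "(\<Sum>j\<in>J. (5 - card (B j)) choose 3) \<le> 20"
    using sum_pairs_le sum_missed_triples_le unfolding P choose_small by simp_all
  have w_cases: "card (B j) \<in> {1, 2} \<and> ?w j = 4 \<or> 9 \<le> ?w j" if j: "j \<in> J" for j
  proof -
    have "card (B j) \<in> {0, 1, 2, 3, 4, 5}"
      using card_block_le[OF j] P by auto
    then show ?thesis
      by (auto simp: choose_small)
  qed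
  have sum_w: "(\<Sum>j\<in>J. ?w j) \<le> 50"
    using pairs triples by (simp add: sum.distrib flip: sum_distrib_left)
  have size: "card (B j) \<in> {1, 2}" if j: "j \<in> J" for j
  proof (rule ccontr)
    assume "\<not> ?thesis"
    then have "9 \<le> ?w j"
      using w_cases[OF j] by auto
    moreover have "4 * card (J - {j}) \<le> (\<Sum>i\<in>J - {j}. ?w i)"
      using sum_bounded_below[of "J - {j}" 4 ?w] w_cases by fastforce
    moreover have "(\<Sum>i\<in>J. ?w i) = ?w j + (\<Sum>i\<in>J - {j}. ?w i)"
      using finJ j by (rule sum.remove)
    ultimately show False
      using sum_w J j finJ by simp
  qed
  define J1 J2 where "J1 = {j \<in> J. card (B j) = 1}" and "J2 = {j \<in> J. card (B j) = 2}"
  have J12: "J = J1 \<union> J2" "J1 \<inter> J2 = {}" "finite J1" "finite J2"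
    using size finJ by (auto simp: J1_def J2_def)
  have "(\<Sum>j\<in>J1. card (B j) choose 2) = 0" "(\<Sum>j\<in>J2. card (B j) choose 2) = card J2"
    "(\<Sum>j\<in>J1. (5 - card (B j)) choose 3) = 4 * card J1"
    "(\<Sum>j\<in>J2. (5 - card (B j)) choose 3) = card J2"
    by (simp_all add: J1_def J2_def choose_small)
  then have "card J2 \<le> 10" "4 * card J1 + card J2 \<le> 20" "card J1 + card J2 = 12"
    using pairs triples J card_Un_disjoint[OF J12(3,4,2)]
    by (simp_all add: J12(1) sum.union_disjoint[OF J12(3,4,2)])
  then have card12: "card J1 = 2" "card J2 = 10"
    by auto
  obtain u v where uv: "J1 = {u, v}" "u \<noteq> v"
    using card12(1) by (auto simp: card_2_iff)
  obtain a b where ab: "B u = {a}" "B v = {b}"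
  proof -
    have "card (B u) = 1" "card (B v) = 1"
      using uv(1) unfolding J1_def by blast+
    then show ?thesis
      using that by (metis card_1_singletonE)
  qed
  have "u \<in> J" "v \<in> J"
    using uv(1) J12(1) by auto
  then have "card (B u \<union> B v) \<le> 2" "B u \<union> B v \<subseteq> P"
    using block_subset[of u] block_subset[of v] by (auto simp: ab card_insert_if)
  then obtain Q where Q: "B u \<union> B v \<subseteq> Q" "Q \<subseteq> P" "card Q = 2"
    using exists_subset_between[of "B u \<union> B v" 2 P] P finP by auto
  \<comment> \<open>Ten 2-blocks without repetition exhaust the ten pairs of points.\<close>
  have "B ` J2 = {T. T \<subseteq> P \<and> card T = 2}"
  proof (rule card_subset_eq)
    show "finite {T. T \<subseteq> P \<and> card T = 2}"
      using finP by simp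
    show "B ` J2 \<subseteq> {T. T \<subseteq> P \<and> card T = 2}"
      using block_subset by (auto simp: J2_def)
    have "inj_on B J2"
    proof (rule inj_onI, rule ccontr)
      fix i j assume ij: "i \<in> J2" "j \<in> J2" "B i = B j" "i \<noteq> j"
      then show False
        using card_inter_le[of i j] by (simp add: J2_def)
    qed
    then show "card (B ` J2) = card {T. T \<subseteq> P \<and> card T = 2}"
      using n_subsets[OF finP, of 2] P card12(2) by (simp add: card_image choose_small)
  qed
  then obtain q where q: "q \<in> J2" "B q = Q"
    using Q(2,3) by (metis (mono_tags, lifting) imageE mem_Collect_eq)
  have "card (B u \<union> B v \<union> B q) = 2"
    using Q(1,3) q(2) by (metis Un_absorb1)
  then show False
    using card_union_ge[of u v q] uv q(1) J12(1,2) P by auto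
qed

text \<open>The function \<open>(7 - r) choose 3\<close> lies above the line \<open>22 - 6 * r\<close>, which touches it at
  \<open>r = 2\<close> and \<open>r = 3\<close>. As the missed triples number at most \<open>2 * 35\<close>, nine blocks have total size at
  least \<open>(9 * 22 - 70) / 6 > 21\<close>, so some point \<open>p\<close> lies in four of them. Off \<open>p\<close> these four are disjoint
  subsets of six points, any three with at least four points in total. This forces the two largest to have
  two points each off \<open>p\<close>, and the two smallest to have union \<open>U\<close> of size 3, \<open>p\<close> included. Any further
  block must contribute two points outside \<open>U\<close> for the triple condition, and it meets each of the two
  large blocks at most once, so outside \<open>U\<close> it consists of one point from each. These traces are
  distinct by the pair condition, so there are at most \<open>2 * 2\<close> further blocks, one short of the
  five that remain.\<close>

lemma seven_points_card_neq_9: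
  assumes P: "card P = 7"
  shows "card J \<noteq> 9"
proof
  assume J: "card J = 9"
  have triples: "(\<Sum>j\<in>J. (7 - card (B j)) choose 3) \<le> 70"
    using sum_missed_triples_le unfolding P choose_small by simp
  have tangent: "22 \<le> ((7 - card (B j)) choose 3) + 6 * card (B j)" if j: "j \<in> J" for j
  proof -
    have "card (B j) \<in> {0, 1, 2, 3, 4, 5, 6, 7}"
      using card_block_le[OF j] P by auto
    then show ?thesis
      by (auto simp: choose_small)
  qed
  have "22 * 9 \<le> (\<Sum>j\<in>J. ((7 - card (B j)) choose 3) + 6 * card (B j))"
    using sum_bounded_below[of J 22, OF tangent] by (simp add: J)
  then have sizes: "22 \<le> (\<Sum>j\<in>J. card (B j))"
    using triples by (simp add: sum.distrib flip: sum_distrib_left)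
  have "(\<Sum>p\<in>P. card {j \<in> J. p \<in> B j}) = (\<Sum>j\<in>J. card {p \<in> P. p \<in> B j})"
    using finP finJ by (intro sum_multicount_gen) auto
  also have "\<dots> = (\<Sum>j\<in>J. card (B j))"
  proof (rule sum.cong[OF refl])
    fix j assume "j \<in> J"
    then have "{p \<in> P. p \<in> B j} = B j" using block_subset by auto
    then show "card {p \<in> P. p \<in> B j} = card (B j)" by simp
  qed
  finally have "\<not> (\<forall>p\<in>P. card {j \<in> J. p \<in> B j} \<le> 3)"
    using sizes sum_bounded_above[of P "\<lambda>p. card {j \<in> J. p \<in> B j}" 3] P by auto
  then obtain p where p: "p \<in> P" "4 \<le> card {j \<in> J. p \<in> B j}"
    by (auto simp: not_le)
  obtain D where D: "D \<subseteq> {j \<in> J. p \<in> B j}" "card D = 4"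
    using obtain_subset_with_card_n[OF p(2)] by blast
  define L where "L j = B j - {p}" for j
  have finD: "finite D"
    using D(2) by (simp add: card_ge_0_finite)
  have in_D: "j \<in> J" "p \<in> B j" "B j = insert p (L j)" "finite (L j)" "L j \<subseteq> P - {p}"
    if "j \<in> D" for j
    using that D(1) finite_block[of j] block_subset[of j] by (auto simp: L_def)
  have L_disjoint: "L i \<inter> L j = {}" if "i \<in> D" "j \<in> D" "i \<noteq> j" for i j
    using common_point_unique[OF in_D(1) in_D(1) that(3) in_D(2) in_D(2)] that by (auto simp: L_def)
  have L_three: "4 \<le> card (L i) + card (L j) + card (L k)"
    if ijk: "i \<in> D" "j \<in> D" "k \<in> D" "i \<noteq> j" "i \<noteq> k" "j \<noteq> k" for i j k
  proof -
    have "B i \<union> B j \<union> B k = insert p (L i \<union> L j \<union> L k)"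
      using in_D(2) ijk(1-3) by (auto simp: L_def)
    then have "card (B i \<union> B j \<union> B k) \<le> Suc (card (L i \<union> L j \<union> L k))"
      using card_insert_le_m1[of "Suc (card (L i \<union> L j \<union> L k))" "L i \<union> L j \<union> L k" p] by simp
    also have "card (L i \<union> L j \<union> L k) \<le> card (L i) + card (L j) + card (L k)"
      using card_Un_le[of "L i" "L j"] card_Un_le[of "L i \<union> L j" "L k"] by linarith
    finally show ?thesis
      using card_union_ge[of i j k] ijk in_D(1) P by fastforce
  qed
  have "(\<Sum>j\<in>D. card (L j)) = card (\<Union>j\<in>D. L j)"
    using finD in_D(4) L_disjoint by (intro card_UN_disjoint[symmetric]) auto
  also have "\<dots> \<le> card (P - {p})"
    using in_D(5) finP by (intro card_mono) auto
  finally have sum_L: "(\<Sum>j\<in>D. card (L j)) \<le> 6"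
    using P p(1) finP by simp
  \<comment> \<open>Name the four blocks so that \<open>i\<close> and \<open>j\<close> are the two smallest.\<close>
  have smallest: "\<exists>i\<in>E. \<forall>j\<in>E. card (L i) \<le> card (L j)" if "E \<noteq> {}" for E
    using ex_has_least_nat[of "\<lambda>i. i \<in> E" _ "\<lambda>i. card (L i)"] that by blast
  have "D \<noteq> {}"
    using D(2) by force
  then obtain i where i: "i \<in> D" "\<forall>j\<in>D. card (L i) \<le> card (L j)"
    using smallest by blast
  have "card (D - {i}) = 3"
    using D(2) i(1) finD by simp
  then have "D - {i} \<noteq> {}"
    by force
  from smallest[OF this]
  obtain j where j: "j \<in> D - {i}" "\<forall>k\<in>D - {i}. card (L j) \<le> card (L k)" ..
  have "card (D - {i, j}) = 2"
    using D(2) i(1) j(1) finD by (auto simp: card_Diff_subset card_insert_if)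
  then obtain k l where kl: "D - {i, j} = {k, l}" "k \<noteq> l"
    by (auto simp: card_2_iff)
  have D_eq: "D = {i, j, k, l}"
    using kl(1) i(1) j(1) by auto
  have distinct: "i \<noteq> j" "i \<noteq> k" "i \<noteq> l" "j \<noteq> k" "j \<noteq> l" "k \<noteq> l"
    using kl j(1) by auto
  have "card (L i) + card (L j) + card (L k) + card (L l) \<le> 6"
    using sum_L distinct by (simp add: D_eq)
  moreover have "4 \<le> card (L i) + card (L j) + card (L k)" "4 \<le> card (L i) + card (L j) + card (L l)"
    using L_three distinct by (simp_all add: D_eq)
  moreover have "card (L i) \<le> card (L j)" "card (L j) \<le> card (L k)" "card (L j) \<le> card (L l)"
    using i(2) j(2) distinct by (simp_all add: D_eq)
  \<comment> \<open>If the second smallest had two points off \<open>p\<close>, then so would the two larger ones, and the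
    smallest would have none.\<close>
  ultimately have L_sizes: "card (L i) + card (L j) = 2" "card (L k) = 2" "card (L l) = 2"
    by (cases "card (L j) \<le> 1"; linarith)+
  define U where "U = B i \<union> B j"
  have ijkl: "i \<in> D" "j \<in> D" "k \<in> D" "l \<in> D"
    by (auto simp: D_eq)
  have U_eq: "U = insert p (L i \<union> L j)"
    using in_D(2) ijkl by (auto simp: U_def L_def)
  have "card (L i \<union> L j) = 2"
    using L_sizes(1) L_disjoint[of i j] in_D(4) distinct ijkl by (simp add: card_Un_disjoint)
  then have card_U: "card U = 3" and finU: "finite U"
    using in_D(4) ijkl by (auto simp: U_eq L_def)
  have U_sub: "U \<subseteq> P"
    using block_subset in_D(1) ijkl by (auto simp: U_def)
  have rest: "P - U = L k \<union> L l"
  proof (rule sym, rule card_subset_eq)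
    show "finite (P - U)" using finP by simp
    have "L k \<inter> (L i \<union> L j) = {}" "L l \<inter> (L i \<union> L j) = {}"
      using L_disjoint distinct ijkl by blast+
    then show "L k \<union> L l \<subseteq> P - U"
      using in_D(5)[of k] in_D(5)[of l] ijkl by (auto simp: U_eq)
    have "card (L k \<union> L l) = 4"
      using L_sizes L_disjoint[of k l] in_D(4) distinct ijkl by (simp add: card_Un_disjoint)
    then show "card (L k \<union> L l) = card (P - U)"
      using card_Diff_subset[OF finU U_sub] card_U P by simp
  qed
  let ?pairs = "(\<lambda>(x, y). {x, y}) ` (L k \<times> L l)"
  have trace: "B h - U \<in> ?pairs" if h: "h \<in> J - D" for h
  proof -
    have h': "h \<in> J" "h \<noteq> i" "h \<noteq> j" "h \<noteq> k" "h \<noteq> l"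
      using h by (auto simp: D_eq)
    have "card (B i \<union> B j \<union> B h) = card U + card (B h - U)"
      using finU finite_block[OF h'(1)] card_Un_disjoint[of U "B h - U"] by (simp add: U_def)
    then have two: "2 \<le> card (B h - U)"
      using card_union_ge[of i j h] in_D(1) ijkl distinct h' P card_U by simp
    have split: "B h - U = (B h \<inter> L k) \<union> (B h \<inter> L l)"
      using rest block_subset[OF h'(1)] by auto
    have small: "card (B h \<inter> L g) \<le> 1" if "g \<in> {k, l}" for g
    proof -
      have "card (B h \<inter> L g) \<le> card (B h \<inter> B g)"
        using finite_block[OF h'(1)] by (intro card_mono) (auto simp: L_def)
      also have "\<dots> \<le> 1"
        using that h' in_D(1) ijkl by (intro card_inter_le) auto
      finally show ?thesis .
    qed
    have "card (B h \<inter> L k) = 1" "card (B h \<inter> L l) = 1"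
      using two card_Un_le[of "B h \<inter> L k" "B h \<inter> L l"] small[of k] small[of l]
      unfolding split by auto
    then obtain x y where "B h \<inter> L k = {x}" "B h \<inter> L l = {y}"
      by (auto simp: card_1_singleton_iff)
    then have "B h - U = {x, y}" "x \<in> L k" "y \<in> L l"
      unfolding split by auto
    then show ?thesis
      by (auto intro!: image_eqI[of _ _ "(x, y)"])
  qed
  have "inj_on (\<lambda>h. B h - U) (J - D)"
  proof (rule inj_onI, rule ccontr)
    fix h g assume hg: "h \<in> J - D" "g \<in> J - D" "B h - U = B g - U" "h \<noteq> g"
    obtain x y where xy: "x \<in> L k" "y \<in> L l" "B h - U = {x, y}"
      using trace[OF hg(1)] by auto
    then have "x \<in> B h" "x \<in> B g" "y \<in> B h" "y \<in> B g"
      using hg(3) by auto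
    then have "x = y"
      using common_point_unique[of h g x y] hg by auto
    then show False
      using xy L_disjoint[of k l] distinct ijkl by auto
  qed
  then have "card (J - D) \<le> card ?pairs"
    using trace by (intro card_inj_on_le) (auto simp: in_D(4) ijkl)
  also have "\<dots> \<le> card (L k \<times> L l)"
    by (intro card_image_le) (auto simp: in_D(4) ijkl)
  also have "\<dots> = 4"
    by (simp add: card_cartesian_product L_sizes)
  finally show False
    using D finD J in_D(1) by (simp add: card_Diff_subset subset_iff)
qed

end

lemma avoiding_family_restrict:
  assumes "avoiding P J B" "finite P" "finite J"
  shows "avoiding_family P J (\<lambda>j. P \<inter> B j)"
proof
  have "P \<inter> (P \<inter> B i) \<inter> (P \<inter> B j) = P \<inter> B i \<inter> B j"
    "P - (P \<inter> B i \<union> P \<inter> B j \<union> P \<inter> B k) = P - (B i \<union> B j \<union> B k)" for i j k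
    by auto
  then show "avoiding P J (\<lambda>j. P \<inter> B j)"
    using assms(1) by (simp add: avoiding_def)
qed (use assms in auto)

lemma avoiding_nat_restrict:
  assumes "avoiding {..<m} {..<n} B" "m' \<le> m"
  shows "avoiding_family {..<m'} {..<n::nat} (\<lambda>j. {..<m'::nat} \<inter> B j)"
  using assms by (intro avoiding_family_restrict avoiding_mono[OF assms(1)]) auto

lemma not_avoiding_4_15: "\<not> avoiding {..<4::nat} {..<15::nat} B"
  using avoiding_family.four_points_card_le_14[OF avoiding_nat_restrict[of 4 15 B 4]] by auto

lemma not_avoiding_5_12: "5 \<le> m \<Longrightarrow> \<not> avoiding {..<m::nat} {..<12::nat} B"
  using avoiding_family.five_points_card_neq_12[OF avoiding_nat_restrict[of m 12 B 5]] by auto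

lemma not_avoiding_7_9: "7 \<le> m \<Longrightarrow> \<not> avoiding {..<m::nat} {..<9::nat} B"
  using avoiding_family.seven_points_card_neq_9[OF avoiding_nat_restrict[of m 9 B 7]] by auto

section \<open>Extremal families\<close>

text \<open>Avoidance for an explicit list of blocks, by recursion over the list so that the simplifier can
  check every pair and every triple once.\<close>

primrec avoiding_list :: "'a set \<Rightarrow> 'a set list \<Rightarrow> bool" where
  "avoiding_list P [] \<longleftrightarrow> True"
| "avoiding_list P (X # L) \<longleftrightarrow>
     (\<forall>Y\<in>set L. card (P \<inter> X \<inter> Y) \<le> 1) \<and>
     sorted_wrt (\<lambda>Y Z. card (P - (X \<union> Y \<union> Z)) \<le> 2) L \<and>
     avoiding_list P L"

lemma avoiding_nth:
  assumes "avoiding_list P L" and "length L = n"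
  shows "avoiding P {..<n} ((!) L)"
  unfolding assms(2)[symmetric]
proof (rule avoiding_ordered)
  fix i j assume "i \<in> {..<length L}" "j \<in> {..<length L}" "i < j"
  then show "card (P \<inter> L ! i \<inter> L ! j) \<le> 1"
    using assms(1)
  proof (induction L arbitrary: i j)
    case (Cons X L)
    then show ?case by (cases i; cases j) auto
  qed simp
next
  fix i j k assume "i \<in> {..<length L}" "j \<in> {..<length L}" "k \<in> {..<length L}" "i < j" "j < k"
  then show "card (P - (L ! i \<union> L ! j \<union> L ! k)) \<le> 2"
    using assms(1)
  proof (induction L arbitrary: i j k)
    case (Cons X L)
    then show ?case
      by (cases i; cases j; cases k) (auto simp: sorted_wrt_iff_nth_less)
  qed simp
qed

text \<open>Every singleton twice and every pair once: equality in \<open>four_points_card_le_14\<close>.\<close>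

lemma avoiding_4_14:
  "avoiding {..<4::nat} {..<14::nat} ((!) [{0}, {0}, {1}, {1}, {2}, {2}, {3}, {3},
     {0, 1}, {0, 2}, {0, 3}, {1, 2}, {1, 3}, {2, 3}])"
  by (rule avoiding_nth) (simp_all add: insert_Diff_if lessThan_nat_numeral lessThan_Suc)

text \<open>The nine edges of the complete bipartite graph between \<open>{0, 1, 2}\<close> and \<open>{3, 4, 5}\<close>, together
  with these two sides. Three edges of a bipartite graph span at least four points, because it has no
  triangle; and a side with any two edges gains at least one point on the other side.\<close>

lemma avoiding_6_11:
  "avoiding {..<6::nat} {..<11::nat} ((!) [{0, 1, 2}, {3, 4, 5},
     {0, 3}, {0, 4}, {0, 5}, {1, 3}, {1, 4}, {1, 5}, {2, 3}, {2, 4}, {2, 5}])"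
  by (rule avoiding_nth) (simp_all add: insert_Diff_if lessThan_nat_numeral lessThan_Suc)

text \<open>The translates of \<open>{0, 1, 3}\<close> modulo 8. The differences of its elements are distinct, so two
  translates share at most one point, and three of them cover at least \<open>3 * 3 - 3 = 6\<close> points. This
  is the Moebius--Kantor configuration.\<close>

lemma avoiding_8_8:
  "avoiding {..<8::nat} {..<8::nat} ((!) [{0, 1, 3}, {1, 2, 4}, {2, 3, 5}, {3, 4, 6},
     {4, 5, 7}, {5, 6, 0}, {6, 7, 1}, {7, 0, 2}])"
  by (rule avoiding_nth) (simp_all add: insert_Diff_if lessThan_nat_numeral lessThan_Suc)

text \<open>A single red row is harmless: a red \<open>K\<^sub>2\<^sub>,\<^sub>2\<close> needs two red rows, and the two other rows
  are too few for a blue \<open>K\<^sub>3\<^sub>,\<^sub>3\<close>.\<close>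

lemma avoiding_3: "avoiding {..<3::nat} J (\<lambda>_. {0})"
proof -
  have "{..<3::nat} \<inter> {0} \<inter> {0} = {0}" "{..<3::nat} - ({0} \<union> {0} \<union> {0}) = {1, 2}"
    by auto
  then show ?thesis
    by (simp add: avoiding_def)
qed

section \<open>The Ramsey numbers\<close>

theorem theorem1:
  fixes m :: nat
  assumes "m \<ge> 2"
  shows "(m \<in> {2, 3} \<longrightarrow>
            BR m (complete_bipartite 2 2) (complete_bipartite 3 3) = None) \<and>
         (m = 4 \<longrightarrow>
            BR m (complete_bipartite 2 2) (complete_bipartite 3 3) = Some 15) \<and>
         (m \<in> {5, 6} \<longrightarrow>
            BR m (complete_bipartite 2 2) (complete_bipartite 3 3) = Some 12) \<and>
         (m \<in> {7, 8} \<longrightarrow>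
            BR m (complete_bipartite 2 2) (complete_bipartite 3 3) = Some 9)"
proof (intro conjI impI)
  assume "m \<in> {2, 3}"
  then have "avoiding {..<m} {..<n::nat} (\<lambda>_. {0})" for n
    by (intro avoiding_mono[OF avoiding_3]) auto
  then show "BR m (complete_bipartite 2 2) (complete_bipartite 3 3) = None"
    by (rule BR_eq_NoneI)
next
  assume "m = 4"
  then show "BR m (complete_bipartite 2 2) (complete_bipartite 3 3) = Some 15"
    using BR_eq_SomeI[OF not_avoiding_4_15 avoiding_4_14] by simp
next
  assume m: "m \<in> {5, 6}"
  show "BR m (complete_bipartite 2 2) (complete_bipartite 3 3) = Some 12"
  proof (rule BR_eq_SomeI)
    show "\<not> avoiding {..<m} {..<12::nat} B" for B
      using m by (intro not_avoiding_5_12) auto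
    show "avoiding {..<m} {..<11::nat} ((!) [{0, 1, 2}, {3, 4, 5},
        {0, 3}, {0, 4}, {0, 5}, {1, 3}, {1, 4}, {1, 5}, {2, 3}, {2, 4}, {2, 5}])"
      using m by (intro avoiding_mono[OF avoiding_6_11]) auto
  qed simp
next
  assume m: "m \<in> {7, 8}"
  show "BR m (complete_bipartite 2 2) (complete_bipartite 3 3) = Some 9"
  proof (rule BR_eq_SomeI)
    show "\<not> avoiding {..<m} {..<9::nat} B" for B
      using m by (intro not_avoiding_7_9) auto
    show "avoiding {..<m} {..<8::nat} ((!) [{0, 1, 3}, {1, 2, 4}, {2, 3, 5}, {3, 4, 6},
        {4, 5, 7}, {5, 6, 0}, {6, 7, 1}, {7, 0, 2}])"
      using m by (intro avoiding_mono[OF avoiding_8_8]) auto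
  qed simp
qed

end
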